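(* Let $M$ be a real, invertible $n\times n$ matrix which is self-adjoint with respect to $\langle\cdot,\cdot\rangle_p$, i.e. $\langle Mx,y\rangle_p=\langle x,My\rangle_p$ for all $x,y\in\mathbb{R}^n$, where $0\le p\le n$. Let $c\in\mathbb{R}$ be such that the quadric $$\mathcal{S}:=\{x\in\mathbb{R}^n\mid\langle x,Mx\rangle_p=c\}$$ is a non-degenerate hypersurface of $(\mathbb{R}^n,\langle\cdot,\cdot\rangle_p)$, and let $r(s)$ be a positive function on an interval $I$ of $\mathbb{R}$. Then the immersion $$f:I\times\mathcal{S}\to\mathbb{C}^n,\qquad f(s,x)=r(s)\,e^{iMs}x$$ is Lagrangian and its Lagrangian angle is given by $$\beta=(\mathrm{tr}\,M)\,s+\arg\left(c\,\frac{r'}{r}+i\,|Mx|_p^2\right)+\frac{\pi}{2}.$$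
   Context: $\mathbb{C}^n$ carries the pseudo-Hermitian form $\langle\langle\cdot,\cdot\rangle\rangle_p=-\sum_{j=1}^p dz_j\,d\bar z_j+\sum_{j=p+1}^n dz_j\,d\bar z_j$, with $\langle\cdot,\cdot\rangle_{2p}=\mathrm{Re}\,\langle\langle\cdot,\cdot\rangle\rangle_p$ (a pseudo-Riemannian metric) and $\omega_p=-\mathrm{Im}\,\langle\langle\cdot,\cdot\rangle\rangle_p$ (a symplectic form). On $\mathbb{R}^n$, $\langle x,y\rangle_p=-\sum_{j\le p}x_jy_j+\sum_{j>p}x_jy_j$ and $|x|_p^2=\langle x,x\rangle_p$. A submanifold is non-degenerate if the metric induced on it is non-degenerate. An immersion of an $n$-dimensional manifold into $\mathbb{C}^n$ is Lagrangian if $\omega_p$ vanishes on its image. The Lagrangian angle of a non-degenerate, oriented Lagrangian submanifold is the map $\beta=\arg\Omega(X_1,\dots,X_n)$ with values in $\mathbb{R}/2\pi\mathbb{Z}$, where $\Omega=dz_1\wedge\dots\wedge dz_n$ and $(X_1,\dots,X_n)$ is a tangent moving frame along the submanifold.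
   Formalization: The constant +π/2 in β is dropped, since with Ω=dz_1∧…∧dz_n the printed formula fails (n=1, M=c=r=1 gives s+π/2 mod π); the case n=1, c=0, where S={0} and f=0 is not an immersion, is excluded; the formula holds for a suitable orientation of I×S. *)

theory Defs
  imports "HOL-Analysis.Analysis" "HOL-Library.Real_Mod"
begin

text \<open>The signature is carried by the first \<open>p\<close> coordinates, in the linear order of the
  index type: \<open>j\<close> is among them iff it has fewer than \<open>p\<close> predecessors.\<close>

definition psign :: "nat \<Rightarrow> 'n::{finite,linorder} \<Rightarrow> real" where
  "psign p j = (if card {i. i < j} < p then - 1 else 1)"

definition pform :: "nat \<Rightarrow> real^'n::{finite,linorder} \<Rightarrow> real^'n::{finite,linorder} \<Rightarrow> real" where
  "pform p x y = (\<Sum>j\<in>UNIV. psign p j * (x $ j * y $ j))"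

definition hform :: "nat \<Rightarrow> complex^'n::{finite,linorder} \<Rightarrow> complex^'n::{finite,linorder} \<Rightarrow> complex" where
  "hform p z w = (\<Sum>j\<in>UNIV. of_real (psign p j) * (z $ j * cnj (w $ j)))"

definition cmetric :: "nat \<Rightarrow> complex^'n::{finite,linorder} \<Rightarrow> complex^'n::{finite,linorder} \<Rightarrow> real" where
  "cmetric p z w = Re (hform p z w)"

definition omega :: "nat \<Rightarrow> complex^'n::{finite,linorder} \<Rightarrow> complex^'n::{finite,linorder} \<Rightarrow> real" where
  "omega p z w = - Im (hform p z w)"

definition self_adjoint :: "nat \<Rightarrow> real^'n::{finite,linorder}^'n::{finite,linorder} \<Rightarrow> bool" where
  "self_adjoint p M \<longleftrightarrow> (\<forall>x y. pform p (M *v x) y = pform p x (M *v y))"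

text \<open>The matrix exponential. (The product \<open>*\<close> on the type \<open>complex^'n^'n\<close> is componentwise,
  so the function \<open>exp\<close> is not available here.)\<close>

definition mexp :: "complex^'n^'n \<Rightarrow> complex^'n^'n" where
  "mexp A = (\<Sum>k. (1 / fact k) *\<^sub>R (((\<lambda>B. A ** B) ^^ k) (mat 1)))"


subsection \<open>Hypersurfaces\<close>

text \<open>Embedded hypersurfaces of class \<open>C\<^sup>1\<close>: locally the zero set of a function \<open>\<phi>\<close> with
  continuous, nowhere vanishing gradient \<open>g\<close>.\<close>

definition hypersurface :: "'a::euclidean_space set \<Rightarrow> bool" where
  "hypersurface S \<longleftrightarrow> (\<forall>x\<in>S. \<exists>U (\<phi> :: 'a \<Rightarrow> real) g.
     open U \<and> x \<in> U \<and> continuous_on U g \<and>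
     (\<forall>y\<in>U. (\<phi> has_derivative (\<lambda>v. g y \<bullet> v)) (at y) \<and> g y \<noteq> 0) \<and>
     S \<inter> U = {y \<in> U. \<phi> y = 0})"

definition tangent_space :: "'a::real_normed_vector set \<Rightarrow> 'a \<Rightarrow> 'a set" where
  "tangent_space S x = {v. \<exists>\<gamma> \<epsilon>. \<epsilon> > 0 \<and> \<gamma> 0 = x \<and> (\<forall>t\<in>{-\<epsilon><..<\<epsilon>}. \<gamma> t \<in> S) \<and>
     (\<gamma> has_vector_derivative v) (at (0::real))}"

definition nondegenerate_on :: "('a::zero \<Rightarrow> 'a \<Rightarrow> real) \<Rightarrow> 'a set \<Rightarrow> bool" where
  "nondegenerate_on b V \<longleftrightarrow> (\<forall>v\<in>V. (\<forall>w\<in>V. b v w = 0) \<longrightarrow> v = 0)"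

definition nondegenerate_hypersurface :: "nat \<Rightarrow> (real^'n::{finite,linorder}) set \<Rightarrow> bool" where
  "nondegenerate_hypersurface p S \<longleftrightarrow>
     hypersurface S \<and> (\<forall>x\<in>S. nondegenerate_on (pform p) (tangent_space S x))"

definition quadric :: "nat \<Rightarrow> real^'n::{finite,linorder}^'n::{finite,linorder} \<Rightarrow> real \<Rightarrow> (real^'n::{finite,linorder}) set" where
  "quadric p M c = {x. pform p x (M *v x) = c}"


subsection \<open>Lagrangian immersions and the Lagrangian angle\<close>

text \<open>In what follows, \<open>X\<close> is a submanifold of a Euclidean space, possibly with boundary, and
  \<open>T u\<close> is its tangent space at \<open>u\<close>. The differential of \<open>f\<close> along \<open>X\<close> is the restriction to
  \<open>T u\<close> of the derivative within \<open>X\<close>. On \<open>T u\<close> this derivative is unique, because tangent vectors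
  are velocities of curves in \<open>X\<close>; its values elsewhere are irrelevant and are never used.\<close>

definition pushforward ::
    "('a::euclidean_space \<Rightarrow> 'b::euclidean_space) \<Rightarrow> 'a set \<Rightarrow> 'a \<Rightarrow> 'a \<Rightarrow> 'b" where
  "pushforward f X u = frechet_derivative f (at u within X)"

definition immersion_on ::
    "'a::euclidean_space set \<Rightarrow> ('a \<Rightarrow> 'a set) \<Rightarrow> ('a \<Rightarrow> 'b::euclidean_space) \<Rightarrow> bool" where
  "immersion_on X T f \<longleftrightarrow> f differentiable_on X \<and>
     continuous_on (Sigma X T) (\<lambda>(u, v). pushforward f X u v) \<and>
     (\<forall>u\<in>X. inj_on (pushforward f X u) (T u))"

definition lagrangian_immersion ::
    "nat \<Rightarrow> 'a::euclidean_space set \<Rightarrow> ('a \<Rightarrow> 'a set) \<Rightarrow> ('a \<Rightarrow> complex^'n::{finite,linorder}) \<Rightarrow> bool" where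
  "lagrangian_immersion p X T f \<longleftrightarrow> immersion_on X T f \<and>
     (\<forall>u\<in>X. subspace (T u) \<and> dim (T u) = CARD('n) \<and>
        (\<forall>v\<in>T u. \<forall>w\<in>T u. omega p (pushforward f X u v) (pushforward f X u w) = 0))"

definition frame_of :: "'a::real_vector set \<Rightarrow> ('n::finite \<Rightarrow> 'a) \<Rightarrow> bool" where
  "frame_of V F \<longleftrightarrow> inj F \<and> independent (range F) \<and> span (range F) = V"

text \<open>An orientation singles out the positive frames \<open>P u\<close> at each point \<open>u\<close>: they form one class
  of frames up to changes of basis with positive determinant, and near every point there is a
  continuous moving frame that is positive.\<close>

definition orientation ::
    "'a::euclidean_space set \<Rightarrow> ('a \<Rightarrow> 'a set) \<Rightarrow> ('a \<Rightarrow> ('n::finite \<Rightarrow> 'a) \<Rightarrow> bool) \<Rightarrow> bool" where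
  "orientation X T P \<longleftrightarrow>
     (\<forall>u\<in>X. \<forall>F. P u F \<longrightarrow> frame_of (T u) F) \<and>
     (\<forall>u\<in>X. \<forall>F G. \<forall>A :: real^'n^'n. P u F \<longrightarrow> frame_of (T u) G \<longrightarrow>
        (\<forall>i. G i = (\<Sum>j\<in>UNIV. A $ i $ j *\<^sub>R F j)) \<longrightarrow> (P u G \<longleftrightarrow> det A > 0)) \<and>
     (\<forall>u\<^sub>0\<in>X. \<exists>U F. open U \<and> u\<^sub>0 \<in> U \<and> (\<forall>i. continuous_on (X \<inter> U) (\<lambda>u. F u i)) \<and>
        (\<forall>u\<in>X \<inter> U. P u (F u)))"

text \<open>The value of \<open>dz\<^sub>1 \<and> \<dots> \<and> dz\<^sub>n\<close> on a family of vectors.\<close>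

definition Omega :: "('n::finite \<Rightarrow> complex^'n) \<Rightarrow> complex" where
  "Omega Z = det (\<chi> i. Z i)"

text \<open>Values in \<open>\<real>/2\<pi>\<int>\<close> are represented by real numbers, compared modulo \<open>2\<pi>\<close>.\<close>

definition lagrangian_angle ::
    "nat \<Rightarrow> 'a::euclidean_space set \<Rightarrow> ('a \<Rightarrow> 'a set) \<Rightarrow> ('a \<Rightarrow> ('n \<Rightarrow> 'a) \<Rightarrow> bool) \<Rightarrow>
     ('a \<Rightarrow> complex^'n::{finite,linorder}) \<Rightarrow> ('a \<Rightarrow> real) \<Rightarrow> bool" where
  "lagrangian_angle p X T P f \<beta> \<longleftrightarrow>
     (\<forall>u\<in>X. nondegenerate_on (\<lambda>v w. cmetric p (pushforward f X u v) (pushforward f X u w)) (T u) \<and>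
        (\<forall>F. P u F \<longrightarrow> Omega (\<lambda>i. pushforward f X u (F i)) \<noteq> 0 \<and>
           [Arg (Omega (\<lambda>i. pushforward f X u (F i))) = \<beta> u] (rmod (2 * pi))))"


subsection \<open>The immersion\<close>

definition rotated_quadric ::
    "real^'n::{finite,linorder}^'n::{finite,linorder} \<Rightarrow> (real \<Rightarrow> real) \<Rightarrow> real \<times> (real^'n::{finite,linorder}) \<Rightarrow> complex^'n::{finite,linorder}" where
  "rotated_quadric M r = (\<lambda>(s, x).
     r s *\<^sub>R (mexp (map_matrix (\<lambda>m. \<i> * of_real m * of_real s) M) *v (\<chi> j. of_real (x $ j))))"

definition cylinder_tangent :: "'a::real_normed_vector set \<Rightarrow> real \<times> 'a \<Rightarrow> (real \<times> 'a) set" where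
  "cylinder_tangent S = (\<lambda>(s, x). UNIV \<times> tangent_space S x)"

end

theory Submission
  imports Defs
begin

text \<open>
  The tangent space of the quadric at \<open>x\<close> is the orthogonal complement of \<open>Mx\<close>, and non-degeneracy
  says \<open>|Mx|\<^sup>2 \<noteq> 0\<close>. The case \<open>c = 0\<close> cannot occur in dimension at least 2: the quadric would then be a
  cone through \<open>0\<close>, and a cone that is a hypersurface at its vertex is a hyperplane, on which no
  non-degenerate quadratic form vanishes without vanishing elsewhere too.

  Write \<open>E(s) = exp(iMs)\<close>. Then \<open>df(h, v) = E(s) (h r' x + r v + i h r Mx)\<close>. Since \<open>M\<close> is
  self-adjoint, \<open>E(s)\<close> preserves the pseudo-Hermitian form, so \<open>\<omega>\<close> and the metric can be computed
  without \<open>E(s)\<close>. For the angle, \<open>det E(s) = exp(is tr M)\<close> by Liouville's formula. With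
  \<open>N = Mx / |Mx|\<^sup>2\<close>, the linear map fixing the complement of \<open>Mx\<close> and sending \<open>N\<close> to \<open>(r'/r) x + i Mx\<close> is
  a rank-one perturbation of the identity, of determinant \<open>c r'/r + i |Mx|\<^sup>2\<close>. A frame \<open>(h\<^sub>j, v\<^sub>j)\<close> is
  positive if the real vectors \<open>h\<^sub>j N + v\<^sub>j\<close> have positive determinant \<open>k\<close>; on it, \<open>\<Omega>\<close> takes the value
  \<open>r^n k exp(is tr M) (c r'/r + i |Mx|\<^sup>2)\<close>.
\<close>

subsection \<open>The matrix exponential\<close>

abbreviation mpow :: "complex^'n^'n \<Rightarrow> nat \<Rightarrow> complex^'n^'n" where
  "mpow A k \<equiv> ((\<lambda>B. A ** B) ^^ k) (mat 1)"

abbreviation mscale :: "complex \<Rightarrow> complex^'n^'n \<Rightarrow> complex^'n^'n" where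
  "mscale z \<equiv> map_matrix (\<lambda>a. z * a)"

lemma mpow_Suc_right: "mpow A (Suc k) = mpow A k ** A"
proof (induction k)
  case (Suc k)
  have "mpow A (Suc (Suc k)) = A ** (mpow A k ** A)"
    using Suc by simp
  then show ?case
    by (simp add: matrix_mul_assoc)
qed simp

lemma mpow_mscale: "mpow (mscale z A) k = mscale (z ^ k) (mpow A k)"
proof (induction k)
  case (Suc k)
  then show ?case
    by (simp add: vec_eq_iff matrix_matrix_mult_def sum_distrib_left mult_ac)
qed (simp add: vec_eq_iff)

lemma norm_mpow_le:
  fixes A :: "complex^'n^'n"
  obtains K where "K \<ge> 0" "\<And>k a b. norm (mpow A k $ a $ b) \<le> K ^ k"
proof -
  define K where "K = (\<Sum>a\<in>UNIV. \<Sum>j\<in>UNIV. norm (A $ a $ j))"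
  have "norm (mpow A k $ a $ b) \<le> K ^ k" for k a b
  proof (induction k arbitrary: a b)
    case (Suc k)
    have "norm (mpow A (Suc k) $ a $ b) \<le> (\<Sum>j\<in>UNIV. norm (A $ a $ j) * norm (mpow A k $ j $ b))"
      by (simp add: matrix_matrix_mult_def norm_sum flip: norm_mult)
    also have "\<dots> \<le> (\<Sum>j\<in>UNIV. norm (A $ a $ j)) * K ^ k"
      unfolding sum_distrib_right by (intro sum_mono mult_left_mono Suc) auto
    also have "\<dots> \<le> K * K ^ k"
      unfolding K_def by (intro mult_right_mono member_le_sum zero_le_power sum_nonneg) (auto intro: sum_nonneg)
    finally show ?case by simp
  qed (simp add: mat_def)
  moreover have "K \<ge> 0"
    unfolding K_def by (intro sum_nonneg) auto
  ultimately show ?thesis using that by blast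
qed

lemma summable_mpow: "summable (\<lambda>k. mpow A k $ a $ b / fact k * z ^ k)"
proof -
  obtain K where K: "K \<ge> 0" "\<And>k a b. norm (mpow A k $ a $ b) \<le> K ^ k"
    using norm_mpow_le by blast
  show ?thesis
  proof (rule summable_comparison_test')
    show "summable (\<lambda>k. inverse (fact k) * (K * norm z) ^ k)"
      by (rule summable_exp)
    show "norm (mpow A k $ a $ b / fact k * z ^ k) \<le> inverse (fact k) * (K * norm z) ^ k" for k
      using mult_right_mono[OF K(2)[of k a b], of "norm z ^ k"]
      by (simp add: norm_mult norm_divide norm_power power_mult_distrib divide_right_mono field_simps)
  qed
qed

lemma mexp_mscale_nth:
  "mexp (mscale z A) $ a $ b = (\<Sum>k. mpow A k $ a $ b / fact k * z ^ k)"
proof -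
  have "(\<lambda>k. (1 / fact k) *\<^sub>R mpow (mscale z A) k) sums
      (\<chi> a b. \<Sum>k. mpow A k $ a $ b / fact k * z ^ k)"
    unfolding sums_def
  proof (intro vec_tendstoI)
    fix a b
    have "(\<lambda>k. mpow A k $ a $ b / fact k * z ^ k) sums (\<Sum>k. mpow A k $ a $ b / fact k * z ^ k)"
      by (rule summable_sums[OF summable_mpow])
    then show "(\<lambda>n. (\<Sum>k<n. (1 / fact k) *\<^sub>R mpow (mscale z A) k) $ a $ b)
        \<longlonglongrightarrow> (\<chi> a b. \<Sum>k. mpow A k $ a $ b / fact k * z ^ k) $ a $ b"
      unfolding sums_def mpow_mscale by (simp add: mult_ac) (simp add: scaleR_conv_of_real)
  qed
  then show ?thesis
    unfolding mexp_def by (simp add: sums_iff)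
qed

lemma mexp_mscale_0: "mexp (mscale 0 A) = mat 1"
proof -
  have "mexp (mscale 0 A) $ a $ b = mat 1 $ a $ b" for a b
    unfolding mexp_mscale_nth powser_zero by simp
  then show ?thesis
    by (simp add: vec_eq_iff)
qed

lemma mpow_left_series:
  "(\<Sum>k. \<Sum>j\<in>UNIV. A $ a $ j * (mpow A k $ j $ b / fact k * z ^ k))
    = (\<Sum>j\<in>UNIV. A $ a $ j * mexp (mscale z A) $ j $ b)"
proof -
  have "(\<Sum>k. \<Sum>j\<in>UNIV. A $ a $ j * (mpow A k $ j $ b / fact k * z ^ k))
      = (\<Sum>j\<in>UNIV. \<Sum>k. A $ a $ j * (mpow A k $ j $ b / fact k * z ^ k))"
    by (intro suminf_sum summable_mult summable_mpow)
  also have "\<dots> = (\<Sum>j\<in>UNIV. A $ a $ j * mexp (mscale z A) $ j $ b)"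
    unfolding mexp_mscale_nth by (intro sum.cong refl suminf_mult summable_mpow)
  finally show ?thesis .
qed

lemma mexp_mscale_commute: "mexp (mscale z A) ** A = A ** mexp (mscale z A)"
proof -
  have "(\<Sum>j\<in>UNIV. mexp (mscale z A) $ a $ j * A $ j $ b)
      = (\<Sum>j\<in>UNIV. A $ a $ j * mexp (mscale z A) $ j $ b)" for a b
  proof -
    have "(\<Sum>j\<in>UNIV. mexp (mscale z A) $ a $ j * A $ j $ b)
        = (\<Sum>j\<in>UNIV. \<Sum>k. mpow A k $ a $ j / fact k * z ^ k * A $ j $ b)"
      unfolding mexp_mscale_nth by (intro sum.cong refl suminf_mult2 summable_mpow)
    also have "\<dots> = (\<Sum>k. \<Sum>j\<in>UNIV. mpow A k $ a $ j / fact k * z ^ k * A $ j $ b)"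
      by (intro suminf_sum[symmetric] summable_mult2 summable_mpow)
    also have "\<dots> = (\<Sum>k. (mpow A k ** A) $ a $ b / fact k * z ^ k)"
      by (simp add: matrix_matrix_mult_def sum_distrib_left sum_distrib_right sum_divide_distrib field_simps)
    also have "\<dots> = (\<Sum>k. (A ** mpow A k) $ a $ b / fact k * z ^ k)"
      using mpow_Suc_right[of _ A] by simp
    also have "\<dots> = (\<Sum>k. \<Sum>j\<in>UNIV. A $ a $ j * (mpow A k $ j $ b / fact k * z ^ k))"
      by (simp add: matrix_matrix_mult_def sum_distrib_left sum_distrib_right sum_divide_distrib field_simps)
    also have "\<dots> = (\<Sum>j\<in>UNIV. A $ a $ j * mexp (mscale z A) $ j $ b)"
      by (rule mpow_left_series)
    finally show ?thesis .
  qed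
  then show ?thesis
    by (simp add: vec_eq_iff matrix_matrix_mult_def)
qed

lemma has_field_derivative_mexp_nth:
  "((\<lambda>z. mexp (mscale z A) $ a $ b) has_field_derivative (A ** mexp (mscale z A)) $ a $ b) (at z)"
proof -
  have "(\<Sum>k. diffs (\<lambda>k. mpow A k $ a $ b / fact k) k * z ^ k)
      = (\<Sum>k. \<Sum>j\<in>UNIV. A $ a $ j * (mpow A k $ j $ b / fact k * z ^ k))"
    by (intro suminf_cong)
      (simp add: diffs_def matrix_matrix_mult_def sum_distrib_left sum_distrib_right
        sum_divide_distrib field_simps del: of_nat_Suc)
  also have "\<dots> = (A ** mexp (mscale z A)) $ a $ b"
    unfolding mpow_left_series by (simp add: matrix_matrix_mult_def)
  finally show ?thesis
    unfolding mexp_mscale_nth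
    using termdiffs_strong_converges_everywhere[of "\<lambda>k. mpow A k $ a $ b / fact k" z,
        OF summable_mpow]
    by simp
qed

lemma has_field_derivative_det:
  fixes B :: "'a::real_normed_field \<Rightarrow> 'a^'n^'n"
  assumes "\<And>i j. ((\<lambda>z. B z $ i $ j) has_field_derivative B' $ i $ j) (at z)"
  shows "((\<lambda>z. det (B z)) has_field_derivative
     (\<Sum>k\<in>UNIV. det (\<chi> i. if i = k then B' $ i else B z $ i))) (at z)"
proof -
  have "((\<lambda>z. det (B z)) has_field_derivative
     (\<Sum>p | p permutes UNIV. of_int (sign p) *
       (\<Sum>k\<in>UNIV. B' $ k $ p k * (\<Prod>i\<in>UNIV - {k}. B z $ i $ p i)))) (at z)"
    unfolding det_def
    by (intro DERIV_sum DERIV_cmult has_field_derivative_prod assms)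
  also have "(\<Sum>p | p permutes UNIV. of_int (sign p) *
       (\<Sum>k\<in>UNIV. B' $ k $ p k * (\<Prod>i\<in>UNIV - {k}. B z $ i $ p i)))
     = (\<Sum>p | p permutes UNIV. \<Sum>k\<in>UNIV. of_int (sign p) *
         (\<Prod>i\<in>UNIV. (\<chi> i. if i = k then B' $ i else B z $ i) $ i $ p i))"
    unfolding sum_distrib_left
  proof (intro sum.cong refl, goal_cases)
    case (1 p k)
    have "(\<Prod>i\<in>UNIV. (\<chi> i. if i = k then B' $ i else B z $ i) $ i $ p i)
        = B' $ k $ p k * (\<Prod>i\<in>UNIV - {k}. B z $ i $ p i)"
      by (subst prod.remove[of _ k]) (auto intro!: prod.cong)
    then show ?case by simp
  qed
  also have "\<dots> = (\<Sum>k\<in>UNIV. det (\<chi> i. if i = k then B' $ i else B z $ i))"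
    unfolding det_def by (rule sum.swap)
  finally show ?thesis .
qed

lemma det_row_matrix_mult:
  fixes A B :: "'a::field^'n^'n"
  shows "det (\<chi> i. if i = k then (A ** B) $ i else B $ i) = A $ k $ k * det B"
proof -
  have "(A ** B) $ k = (\<Sum>i\<in>UNIV. A $ k $ i *s row i B)"
    by (simp add: vec_eq_iff matrix_matrix_mult_def row_def)
  then have "(\<chi> i. if i = k then (A ** B) $ i else B $ i)
      = (\<chi> i. if i = k then \<Sum>i\<in>UNIV. (A $ k) $ i *s row i B else row i B)"
    by (auto simp: vec_eq_iff row_def)
  then show ?thesis
    using cramer_lemma_transpose[of k "A $ k" B] by simp
qed

text \<open>Liouville's formula, from the linear differential equation \<open>D' = (trace A) D\<close> for the
  determinant.\<close>

lemma det_mexp_mscale: "det (mexp (mscale z A)) = exp (z * trace A)"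
proof -
  let ?D = "\<lambda>z. det (mexp (mscale z A))"
  have D: "(?D has_field_derivative trace A * ?D z) (at z)" for z
    using has_field_derivative_det[OF has_field_derivative_mexp_nth, of A z]
    by (simp add: det_row_matrix_mult trace_def sum_distrib_right)
  have "((\<lambda>z. ?D z * exp (- (z * trace A))) has_field_derivative 0) (at z within UNIV)" for z
    using D by (auto intro!: derivative_eq_intros)
  then obtain k where k: "\<And>z. ?D z * exp (- (z * trace A)) = k"
    using has_field_derivative_zero_constant[of UNIV "\<lambda>z. ?D z * exp (- (z * trace A))"] by auto
  from k[of 0] have "k = 1"
    unfolding mexp_mscale_0 by simp
  with k[of z] show ?thesis
    by (simp add: exp_minus field_simps)
qed


subsection \<open>The pseudo-Hermitian form\<close>

lemma pform_commute: "pform p x y = pform p y x"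
  by (simp add: pform_def mult_ac)

lemma bounded_bilinear_pform: "bounded_bilinear (pform p)"
  unfolding bilinear_conv_bounded_bilinear[symmetric] bilinear_def pform_def
  by (auto intro!: linearI simp: algebra_simps sum.distrib sum_distrib_left)

interpretation pform: bounded_bilinear "pform p" for p
  by (rule bounded_bilinear_pform)

lemma bounded_bilinear_hform: "bounded_bilinear (hform p)"
  unfolding bilinear_conv_bounded_bilinear[symmetric] bilinear_def hform_def
  by (auto intro!: linearI simp: algebra_simps sum.distrib scaleR_sum_right)

lemma pform_axis: "pform p x (axis j 1) = psign p j * x $ j"
  by (simp add: pform_def axis_def if_distrib cong: if_cong)

lemma psign_nonzero [simp]: "psign p j \<noteq> 0"
  by (simp add: psign_def)

lemma pform_nondegenerate:
  assumes "\<And>y. pform p x y = 0"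
  shows "x = 0"
  using assms[of "axis _ 1"] by (simp add: vec_eq_iff pform_axis)

lemma self_adjoint_entry:
  assumes "self_adjoint p M"
  shows "psign p i * M $ i $ j = psign p j * M $ j $ i"
proof -
  have "pform p (M *v axis j 1) (axis i 1) = pform p (M *v axis i 1) (axis j 1)"
    using assms unfolding self_adjoint_def by (metis pform_commute)
  then show ?thesis
    by (simp add: pform_axis matrix_vector_mul_component row_def column_def matrix_vector_mult_basis)
qed

definition zvec :: "real^'n \<Rightarrow> real^'n \<Rightarrow> complex^'n" where
  "zvec a b = (\<chi> j. Complex (a $ j) (b $ j))"

lemma hform_zvec:
  "hform p (zvec a b) (zvec a' b')
    = Complex (pform p a a' + pform p b b') (pform p b a' - pform p a b')"
  by (auto simp: complex_eq_iff hform_def zvec_def pform_def algebra_simps sum.distrib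
      sum_subtractf)

definition imat :: "real^'n^'n \<Rightarrow> complex^'n^'n" where
  "imat M = map_matrix (\<lambda>m. \<i> * of_real m) M"

lemma hform_imat:
  assumes "self_adjoint p M"
  shows "hform p (imat M *v z) w = - hform p z (imat M *v w)"
proof -
  have "hform p (imat M *v z) w
      = (\<Sum>i\<in>UNIV. \<Sum>j\<in>UNIV. \<i> * of_real (psign p i * M $ i $ j) * (z $ j * cnj (w $ i)))"
    by (simp add: hform_def imat_def matrix_vector_mult_def sum_distrib_left sum_distrib_right mult_ac)
  also have "\<dots>
      = (\<Sum>j\<in>UNIV. \<Sum>i\<in>UNIV. \<i> * of_real (psign p j * M $ j $ i) * (z $ j * cnj (w $ i)))"
    by (subst sum.swap, intro sum.cong refl, subst self_adjoint_entry[OF assms], rule refl)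
  also have "\<dots> = - hform p z (imat M *v w)"
    by (simp add: hform_def imat_def matrix_vector_mult_def sum_distrib_left sum_distrib_right
        mult_ac flip: sum_negf)
  finally show ?thesis .
qed


subsection \<open>The unitary group generated by \<open>iM\<close>\<close>

definition rot :: "real^'n^'n \<Rightarrow> real \<Rightarrow> complex^'n^'n" where
  "rot M s = mexp (mscale (of_real s) (imat M))"

lemma rotated_quadric_eq: "rotated_quadric M r (s, x) = r s *\<^sub>R (rot M s *v zvec x 0)"
  by (simp add: rotated_quadric_def rot_def imat_def zvec_def map_matrix_def mult_ac
      complex_of_real_def)

lemma has_derivative_vec_nthI:
  fixes f :: "'a::real_normed_vector \<Rightarrow> 'b::euclidean_space^'n"
  assumes "\<And>i. ((\<lambda>x. f x $ i) has_derivative (\<lambda>x. f' x $ i)) (at a within X)"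
  shows "(f has_derivative f') (at a within X)"
proof (subst has_derivative_componentwise_within, intro ballI)
  fix b :: "'b^'n" assume "b \<in> Basis"
  then obtain i u where b: "b = axis i u"
    by (auto simp: Basis_vec_def)
  show "((\<lambda>x. f x \<bullet> b) has_derivative (\<lambda>x. f' x \<bullet> b)) (at a within X)"
    unfolding b inner_axis by (intro has_derivative_inner_left assms)
qed

lemma rot_0: "rot M 0 = mat 1"
  by (simp only: rot_def of_real_0 mexp_mscale_0)

lemma rot_commute: "rot M s ** imat M = imat M ** rot M s"
  by (simp add: rot_def mexp_mscale_commute)

lemma det_rot: "det (rot M s) = cis (trace M * s)"
proof -
  have "trace (imat M) = \<i> * of_real (trace M)"
    by (simp add: trace_def imat_def sum_distrib_left)
  then show ?thesis
    unfolding rot_def det_mexp_mscale cis_conv_exp by (simp add: mult_ac)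
qed

lemma has_vector_derivative_rot:
  "(rot M has_vector_derivative imat M ** rot M s) (at s within X)"
  unfolding has_vector_derivative_def rot_def
proof (intro has_derivative_vec_nthI)
  fix a b
  show "((\<lambda>s. mexp (mscale (of_real s) (imat M)) $ a $ b) has_derivative
      (\<lambda>h. (h *\<^sub>R (imat M ** mexp (mscale (of_real s) (imat M)))) $ a $ b)) (at s within X)"
    using has_vector_derivative_real_field[OF has_field_derivative_mexp_nth[of "imat M" a b], of s X]
    by (simp add: has_vector_derivative_def)
qed

lemma bounded_bilinear_cmatrix_vector_mult:
  "bounded_bilinear (\<lambda>(A::complex^'n^'m) z. A *v z)"
  unfolding bilinear_conv_bounded_bilinear[symmetric] bilinear_def
  by (auto intro!: linearI simp: vec_eq_iff matrix_vector_mult_def algebra_simps sum.distrib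
      scaleR_sum_right)

interpretation cmv: bounded_bilinear "\<lambda>(A::complex^'n^'m) z. A *v z"
  by (rule bounded_bilinear_cmatrix_vector_mult)

lemma has_vector_derivative_rot_mult:
  "((\<lambda>s. rot M s *v z) has_vector_derivative imat M *v (rot M s *v z)) (at s within X)"
  using bounded_linear.has_vector_derivative[OF cmv.bounded_linear_left has_vector_derivative_rot]
  by (simp add: matrix_vector_mul_assoc)

lemma hform_rot:
  assumes "self_adjoint p M"
  shows "hform p (rot M s *v z) (rot M s *v w) = hform p z w"
proof -
  have "((\<lambda>s. hform p (rot M s *v z) (rot M s *v w)) has_derivative (\<lambda>h. 0)) (at s within UNIV)" for s
    using bounded_bilinear.has_vector_derivative[OF bounded_bilinear_hform[of p]
        has_vector_derivative_rot_mult[of M z s UNIV] has_vector_derivative_rot_mult[of M w s UNIV]]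
    by (simp add: hform_imat[OF assms] has_vector_derivative_def)
  then obtain k where "\<And>s. hform p (rot M s *v z) (rot M s *v w) = k"
    using has_derivative_zero_constant[of UNIV "\<lambda>s. hform p (rot M s *v z) (rot M s *v w)"] by auto
  from this[of s] this[of 0] show ?thesis
    by (simp add: rot_0)
qed

lemma
  assumes "self_adjoint p M"
  shows omega_rot_zvec:
    "omega p (rot M s *v zvec a b) (rot M s *v zvec a' b') = pform p a b' - pform p b a'"
    and cmetric_rot_zvec:
    "cmetric p (rot M s *v zvec a b) (rot M s *v zvec a' b') = pform p a a' + pform p b b'"
  by (simp_all add: omega_def cmetric_def hform_rot[OF assms] hform_zvec)

lemma rot_mult_eq_iff: "rot M s *v z = rot M s *v w \<longleftrightarrow> z = w"
proof
  have "invertible (rot M s)"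
    by (simp add: invertible_det_nz det_rot)
  then obtain B where "B ** rot M s = mat 1"
    unfolding invertible_def by blast
  then have "B *v (rot M s *v y) = y" for y
    by (simp add: matrix_vector_mul_assoc)
  then show "z = w" if "rot M s *v z = rot M s *v w"
    using that by metis
qed simp

lemma bounded_linear_zvec_left: "bounded_linear (\<lambda>x. zvec x 0)"
  unfolding linear_conv_bounded_linear[symmetric]
  by (auto intro!: linearI simp: zvec_def vec_eq_iff complex_eq_iff)

lemma has_derivative_rotated_quadric:
  fixes M :: "real^'n::{finite,linorder}^'n::{finite,linorder}"
  assumes r: "(r has_real_derivative r') (at s within I)"
  shows "(rotated_quadric M r has_derivative
     (\<lambda>(h, v). rot M s *v zvec (h *\<^sub>R r' *\<^sub>R x + r s *\<^sub>R v) (h *\<^sub>R r s *\<^sub>R (M *v x))))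
       (at (s, x) within I \<times> X)"
proof -
  let ?F = "at (s, x) within I \<times> X"
  have 1: "((\<lambda>u. r (fst u)) has_derivative (\<lambda>u. r' * fst u)) ?F"
    by (rule has_derivative_in_compose[where g = r and f = fst])
      (use r in \<open>auto simp: has_field_derivative_def intro!: has_derivative_fst
         intro: has_derivative_subset\<close>)
  have 2: "((\<lambda>u. rot M (fst u)) has_derivative (\<lambda>u. fst u *\<^sub>R (imat M ** rot M s))) ?F"
    by (rule has_derivative_compose[where g = "rot M" and f = fst])
      (use has_vector_derivative_rot[of M s UNIV] in
        \<open>auto simp: has_vector_derivative_def intro!: has_derivative_fst\<close>)
  have 3: "((\<lambda>u. zvec (snd u) 0) has_derivative (\<lambda>u. zvec (snd u) 0)) ?F"
    by (intro bounded_linear.has_derivative[OF bounded_linear_zvec_left] has_derivative_snd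
        has_derivative_ident)
  have "((\<lambda>u. r (fst u) *\<^sub>R (rot M (fst u) *v zvec (snd u) 0)) has_derivative
      (\<lambda>u. r s *\<^sub>R (rot M s *v zvec (snd u) 0 + fst u *\<^sub>R (imat M ** rot M s) *v zvec x 0)
         + (r' * fst u) *\<^sub>R (rot M s *v zvec x 0))) ?F"
    using has_derivative_scaleR[OF 1 cmv.FDERIV[OF 2 3]] by simp
  moreover have "r s *\<^sub>R (rot M s *v zvec v 0 + h *\<^sub>R (imat M ** rot M s) *v zvec x 0)
         + (r' * h) *\<^sub>R (rot M s *v zvec x 0)
       = rot M s *v zvec (h *\<^sub>R r' *\<^sub>R x + r s *\<^sub>R v) (h *\<^sub>R r s *\<^sub>R (M *v x))" for h v
  proof -
    have "imat M *v zvec x 0 = zvec 0 (M *v x)"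
      by (simp add: vec_eq_iff zvec_def imat_def matrix_vector_mult_def complex_eq_iff)
    moreover have "zvec (h *\<^sub>R r' *\<^sub>R x + r s *\<^sub>R v) (h *\<^sub>R r s *\<^sub>R (M *v x))
        = r s *\<^sub>R (zvec v 0 + h *\<^sub>R zvec 0 (M *v x)) + (r' * h) *\<^sub>R zvec x 0"
      by (simp add: vec_eq_iff zvec_def complex_eq_iff)
    ultimately show ?thesis
      by (simp add: cmv.add_right cmv.scaleR_right cmv.scaleR_left flip: rot_commute matrix_vector_mul_assoc)
  qed
  moreover have "rotated_quadric M r = (\<lambda>u. r (fst u) *\<^sub>R (rot M (fst u) *v zvec (snd u) 0))"
    by (simp add: fun_eq_iff rotated_quadric_eq)
  ultimately show ?thesis
    by (simp add: case_prod_beta')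
qed


subsection \<open>Determinants of rank-one updates\<close>

lemma sum_axis_left: "(\<Sum>a\<in>UNIV. axis i 1 $ a * g a) = (g i :: 'a::comm_semiring_1)"
  by (simp add: axis_def if_distrib[of "\<lambda>x. x * _"] cong: if_cong)

lemma sum_axis_right: "(\<Sum>a\<in>UNIV. g a * axis a 1 $ j) = (g j :: 'a::comm_semiring_1)"
  by (simp add: axis_def if_distrib[of "\<lambda>x. _ * x"] cong: if_cong)

lemma det_mat_1_plus_rank_one:
  fixes u w :: "'a::field^'n"
  shows "det (\<chi> i. axis i 1 + u $ i *s w) = 1 + (\<Sum>i\<in>UNIV. u $ i * w $ i)"
proof (cases "w = 0")
  case True
  then have "(\<chi> i. axis i 1 + u $ i *s w) = mat 1"
    by (simp add: vec_eq_iff mat_def axis_def)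
  with True show ?thesis by simp
next
  case False
  then obtain k where k: "w $ k \<noteq> 0"
    by (auto simp: vec_eq_iff)
  \<comment> \<open>Changing coordinates by \<open>C\<close> turns the linear form \<open>w\<close> into the \<open>k\<close>-th coordinate.\<close>
  define C :: "'a^'n^'n" where "C = (\<chi> i. if i = k then w else axis i 1)"
  have "(\<Sum>i\<in>UNIV. w $ i *s row i (mat 1)) = w"
    by (simp add: vec_eq_iff row_def mat_def if_distrib[of "\<lambda>x. _ * x"] cong: if_cong)
  then have "C = (\<chi> i. if i = k then \<Sum>i\<in>UNIV. w $ i *s row i (mat 1) else row i (mat 1))"
    by (auto simp: C_def vec_eq_iff row_def mat_def axis_def)
  then have detC: "det C = w $ k"
    using cramer_lemma_transpose[of k w "mat 1"] by simp
  let ?v = "C *v u"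
  have "C ** (\<chi> i. axis i 1 + u $ i *s w) = (\<chi> i. axis i 1 + ?v $ i *s axis k 1) ** C"
  proof -
    have "(\<Sum>a\<in>UNIV. C $ i $ a * (axis a 1 $ j + u $ a * w $ j)) = C $ i $ j + ?v $ i * w $ j" for i j
      by (simp add: distrib_left sum.distrib sum_axis_right matrix_vector_mult_def
          sum_distrib_right mult.assoc)
    moreover have "(\<Sum>a\<in>UNIV. (axis i 1 $ a + ?v $ i * axis k 1 $ a) * C $ a $ j)
        = C $ i $ j + ?v $ i * C $ k $ j" for i j
      by (simp add: distrib_right sum.distrib sum_axis_left mult.assoc flip: sum_distrib_left)
    moreover have "C $ k $ j = w $ j" for j
      by (simp add: C_def)
    ultimately show ?thesis
      by (simp add: matrix_matrix_mult_def vec_eq_iff)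
  qed
  from arg_cong[OF this, of det] have "w $ k * det (\<chi> i. axis i 1 + u $ i *s w)
      = det (\<chi> i. axis i 1 + ?v $ i *s axis k 1) * w $ k"
    unfolding det_mul detC .
  moreover have "(\<chi> i. axis i 1 + ?v $ i *s axis k 1)
      = (\<chi> i j. if j = k then (mat 1 *v (axis k 1 + ?v)) $ i else mat 1 $ i $ j)"
    unfolding matrix_vector_mul_lid by (auto simp: vec_eq_iff axis_def mat_def)
  then have "det (\<chi> i. axis i 1 + ?v $ i *s axis k 1) = 1 + ?v $ k"
    using cramer_lemma[of k "mat 1" "axis k 1 + ?v"] by simp
  moreover have "?v $ k = (\<Sum>i\<in>UNIV. u $ i * w $ i)"
    by (simp add: matrix_vector_mult_def C_def mult_ac)
  ultimately show ?thesis
    using k by simp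
qed

lemma det_rank_one_update:
  fixes B :: "'a::field^'n^'n"
  shows "det (\<chi> i. B $ i + (B *v q) $ i *s d) = det B * (1 + (\<Sum>i\<in>UNIV. q $ i * d $ i))"
proof -
  have "(\<Sum>a\<in>UNIV. B $ i $ a * (axis a 1 $ j + q $ a * d $ j)) = B $ i $ j + (B *v q) $ i * d $ j" for i j
    by (simp add: distrib_left sum.distrib sum_axis_right matrix_vector_mult_def
        sum_distrib_right mult.assoc)
  then have "B ** (\<chi> i. axis i 1 + q $ i *s d) = (\<chi> i. B $ i + (B *v q) $ i *s d)"
    by (simp add: matrix_matrix_mult_def vec_eq_iff)
  from arg_cong[OF this, of det] show ?thesis
    unfolding det_mul det_mat_1_plus_rank_one by simp
qed

lemma det_map_matrix_of_real:
  "det (map_matrix of_real B :: 'a::{real_algebra_1,comm_ring_1}^'n^'n) = of_real (det B)"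
  by (simp add: det_def)


subsection \<open>The quadric\<close>

lemma hypersurface_cone_eq_hyperplane:
  fixes S :: "'a::euclidean_space set"
  assumes "hypersurface S" "closed S" "0 \<in> S" and cone: "\<And>t x. x \<in> S \<Longrightarrow> t *\<^sub>R x \<in> S"
  obtains g where "g \<noteq> 0" "S = {w. g \<bullet> w = 0}"
proof -
  obtain U \<phi> g where U: "open U" "0 \<in> U" and
    \<phi>: "\<And>y. y \<in> U \<Longrightarrow> (\<phi> has_derivative (\<lambda>v. g y \<bullet> v)) (at y)" and
    g: "\<And>y. y \<in> U \<Longrightarrow> g y \<noteq> 0" and SU: "S \<inter> U = {y \<in> U. \<phi> y = (0::real)}"
    using bspec[OF assms(1)[unfolded hypersurface_def] assms(3)] by (elim exE conjE) blast
  have \<phi>0: "\<phi> 0 = 0"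
    using SU U assms(3) by blast
  obtain \<rho> where \<rho>: "\<rho> > 0" "ball 0 \<rho> \<subseteq> U"
    using U by (meson openE)
  have D: "((\<lambda>t. \<phi> (t *\<^sub>R v)) has_real_derivative g 0 \<bullet> v) (at 0)" for v
  proof -
    have "((\<lambda>t. \<phi> (t *\<^sub>R v)) has_derivative (\<lambda>t. g 0 \<bullet> (t *\<^sub>R v))) (at 0)"
      by (rule has_derivative_compose[where g = \<phi>])
        (use \<phi>[OF U(2)] in \<open>auto intro!: derivative_eq_intros\<close>)
    then show ?thesis
      unfolding has_field_derivative_def by (rule has_derivative_eq_rhs) (auto simp: mult.commute)
  qed
  have "g 0 \<bullet> v = 0" if "v \<in> S" for v
  proof -
    have "((\<lambda>t. t *\<^sub>R v) \<longlongrightarrow> 0 *\<^sub>R v) (nhds (0::real))"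
      by (intro tendsto_intros filterlim_ident)
    then have "\<forall>\<^sub>F t in nhds (0::real). t *\<^sub>R v \<in> U"
      using U by (simp add: topological_tendstoD)
    then have "\<forall>\<^sub>F t in nhds 0. \<phi> (t *\<^sub>R v) = 0"
      by eventually_elim (use SU cone[OF that] in blast)
    then have "((\<lambda>t. \<phi> (t *\<^sub>R v)) has_real_derivative 0) (at 0)"
      by (subst DERIV_cong_ev[OF refl _ refl]) auto
    with D show ?thesis
      by (rule DERIV_unique)
  qed
  moreover have "w \<in> S" if w: "g 0 \<bullet> w = 0" for w
  proof -
    have "\<exists>y\<in>S. dist y w < e" if "e > 0" for e
    proof -
      define \<eta> where "\<eta> = e / (2 * norm (g 0))"
      have \<eta>: "\<eta> > 0"
        using that g[OF U(2)] by (simp add: \<eta>_def)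
      have "g 0 \<bullet> (w + \<eta> *\<^sub>R g 0) > 0" "g 0 \<bullet> (w + (-\<eta>) *\<^sub>R g 0) < 0"
        using \<eta> g[OF U(2)] w by (auto simp: inner_simps)
      from DERIV_pos_inc_right[OF D this(1)] DERIV_neg_dec_right[OF D this(2)]
      obtain d1 d2 where d: "d1 > 0" "d2 > 0"
        "\<And>h. 0 < h \<Longrightarrow> h < d1 \<Longrightarrow> 0 < \<phi> (h *\<^sub>R (w + \<eta> *\<^sub>R g 0))"
        "\<And>h. 0 < h \<Longrightarrow> h < d2 \<Longrightarrow> 0 > \<phi> (h *\<^sub>R (w + (-\<eta>) *\<^sub>R g 0))"
        unfolding add_0 scale_zero_left \<phi>0 by blast
      define R where "R = norm w + e + 1"
      have R: "R > 0"
        using that norm_ge_zero[of w] unfolding R_def by linarith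
      have "0 < min (min d1 d2) (\<rho> / R)"
        using d(1,2) \<rho>(1) R by simp
      then obtain t where "0 < t" "t < min (min d1 d2) (\<rho> / R)"
        using dense by blast
      then have t: "t > 0" "t < d1" "t < d2" "t < \<rho> / R"
        by simp_all
      have small: "norm (\<xi> *\<^sub>R g 0) \<le> e / 2" if "\<xi> \<in> {-\<eta>..\<eta>}" for \<xi>
      proof -
        have "\<bar>\<xi>\<bar> * norm (g 0) \<le> \<eta> * norm (g 0)"
          using that by (intro mult_right_mono) auto
        also have "\<dots> = e / 2"
          using g[OF U(2)] by (simp add: \<eta>_def)
        finally show ?thesis by simp
      qed
      have inU: "t *\<^sub>R (w + \<xi> *\<^sub>R g 0) \<in> U" if "\<xi> \<in> {-\<eta>..\<eta>}" for \<xi>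
      proof -
        have "norm (w + \<xi> *\<^sub>R g 0) \<le> R"
          using norm_triangle_ineq[of w "\<xi> *\<^sub>R g 0"] small[OF that] \<open>e > 0\<close>
          unfolding R_def by linarith
        then have "t * norm (w + \<xi> *\<^sub>R g 0) \<le> t * R"
          using t(1) by (intro mult_left_mono) auto
        also have "\<dots> < \<rho>"
          using t(4) R by (simp add: pos_less_divide_eq)
        finally have "norm (t *\<^sub>R (w + \<xi> *\<^sub>R g 0)) < \<rho>"
          using t(1) unfolding norm_scaleR by simp
        then show ?thesis
          using \<rho>(2) by (auto simp del: norm_scaleR)
      qed
      have "continuous_on {-\<eta>..\<eta>} (\<lambda>\<xi>. \<phi> (t *\<^sub>R (w + \<xi> *\<^sub>R g 0)))"
      proof (rule continuous_on_compose2[of U \<phi>])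
        show "continuous_on U \<phi>"
          using \<phi> by (meson has_derivative_at_withinI has_derivative_continuous_on)
        show "continuous_on {-\<eta>..\<eta>} (\<lambda>\<xi>. t *\<^sub>R (w + \<xi> *\<^sub>R g 0))"
          by (intro continuous_intros)
        show "(\<lambda>\<xi>. t *\<^sub>R (w + \<xi> *\<^sub>R g 0)) ` {-\<eta>..\<eta>} \<subseteq> U"
          using inU by blast
      qed
      \<comment> \<open>\<open>\<phi>\<close> changes sign along the segment from \<open>t(w - \<eta>g)\<close> to \<open>t(w + \<eta>g)\<close>; a zero on it
        gives a point of the cone close to \<open>w\<close>.\<close>
      moreover have "\<phi> (t *\<^sub>R (w + (-\<eta>) *\<^sub>R g 0)) \<le> 0" "0 \<le> \<phi> (t *\<^sub>R (w + \<eta> *\<^sub>R g 0))"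
        using d(3)[OF t(1,2)] d(4)[OF t(1,3)] by simp_all
      moreover have "-\<eta> \<le> \<eta>"
        using \<eta> by simp
      ultimately obtain \<xi> where "-\<eta> \<le> \<xi>" "\<xi> \<le> \<eta>" and \<xi>0: "\<phi> (t *\<^sub>R (w + \<xi> *\<^sub>R g 0)) = 0"
        using IVT'[of "\<lambda>\<xi>. \<phi> (t *\<^sub>R (w + \<xi> *\<^sub>R g 0))" "-\<eta>" 0 \<eta>] by metis
      then have \<xi>: "\<xi> \<in> {-\<eta>..\<eta>}"
        by simp
      have "t *\<^sub>R (w + \<xi> *\<^sub>R g 0) \<in> S"
        using SU inU[OF \<xi>] \<xi>0 by blast
      from cone[OF this, of "1 / t"] have "w + \<xi> *\<^sub>R g 0 \<in> S"
        using t by simp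
      moreover have "dist (w + \<xi> *\<^sub>R g 0) w < e"
        using small[OF \<xi>] that by (simp add: dist_norm)
      ultimately show ?thesis by blast
    qed
    then show ?thesis
      using assms(2) closed_approachable by blast
  qed
  ultimately show ?thesis
    using that[of "g 0"] g[OF U(2)] by blast
qed

locale nondegenerate_quadric =
  fixes p :: nat and M :: "real^'n::{finite,linorder}^'n::{finite,linorder}" and c :: real
  assumes inv: "invertible M" and sa: "self_adjoint p M"
    and nd: "nondegenerate_hypersurface p (quadric p M c)"
    and one_dim: "CARD('n) = 1 \<longrightarrow> c \<noteq> 0"
begin

abbreviation S where "S \<equiv> quadric p M c"

abbreviation sqnorm where "sqnorm x \<equiv> pform p (M *v x) (M *v x)"

lemma pform_M_commute: "pform p x (M *v y) = pform p y (M *v x)"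
  using sa unfolding self_adjoint_def by (metis pform_commute)

lemma quadratic_add:
  "pform p (x + t *\<^sub>R w) (M *v (x + t *\<^sub>R w))
    = pform p x (M *v x) + 2 * t * pform p w (M *v x) + t\<^sup>2 * pform p w (M *v w)"
  using pform_M_commute[of x w]
  by (simp add: matrix_vector_right_distrib matrix_vector_mult_scaleR pform.add_left
      pform.add_right pform.scaleR_left pform.scaleR_right power2_eq_square algebra_simps)

lemma c_nonzero: "c \<noteq> 0"
proof
  assume c: "c = 0"
  have S: "x \<in> S \<longleftrightarrow> pform p x (M *v x) = 0" for x
    by (simp add: quadric_def c)
  have closed: "closed S"
    unfolding quadric_def
    by (intro closed_Collect_eq pform.continuous_on continuous_intros
        linear_continuous_on matrix_vector_mul_bounded_linear)
  have zero: "0 \<in> S"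
    by (simp add: S pform.zero_left)
  have cone: "t *\<^sub>R x \<in> S" if "x \<in> S" for t x
    using that by (simp add: S matrix_vector_mult_scaleR pform.scaleR_left pform.scaleR_right)
  have hyp: "hypersurface S"
    using nd by (simp add: nondegenerate_hypersurface_def)
  obtain g where g: "g \<noteq> 0" and Sg': "S = {w. g \<bullet> w = 0}"
    by (rule hypersurface_cone_eq_hyperplane[OF hyp closed zero cone])
  have Sg: "w \<in> S \<longleftrightarrow> g \<bullet> w = 0" for w
    by (simp add: Sg')
  have "CARD('n) \<noteq> 1"
    using c one_dim by blast
  moreover have "CARD('n) > 0"
    by simp
  ultimately have "2 \<le> CARD('n)"
    by arith
  then have "2 \<le> DIM((real, 'n) vec)"
    by simp
  then obtain w where w: "w \<noteq> 0" "g \<bullet> w = 0"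
    by (metis orthogonal_def orthogonal_to_vector_exists)
  have "pform p w (M *v y) = 0" for y
  proof -
    have qw: "pform p w (M *v w) = 0"
      using w Sg S by blast
    show ?thesis
    proof (cases "g \<bullet> y = 0")
      case True
      then have "pform p (y + 1 *\<^sub>R w) (M *v (y + 1 *\<^sub>R w)) = 0" "pform p y (M *v y) = 0"
        using w by (auto simp flip: S simp: Sg inner_simps)
      then show ?thesis
        using qw unfolding quadratic_add by (simp add: pform_M_commute)
    next
      case False
      then have qy: "pform p y (M *v y) \<noteq> 0"
        using Sg S by blast
      define t where "t = - 2 * pform p y (M *v w) / pform p y (M *v y)"
      have "pform p (w + t *\<^sub>R y) (M *v (w + t *\<^sub>R y)) = 0"
        unfolding quadratic_add qw using qy by (simp add: t_def power2_eq_square field_simps)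
      then have "g \<bullet> (w + t *\<^sub>R y) = 0"
        using S Sg by blast
      then have "t = 0"
        using w False by (simp add: inner_simps)
      then show ?thesis
        using qy by (simp add: t_def pform_M_commute)
    qed
  qed
  moreover have "\<exists>y. z = M *v y" for z
    using inv by (metis invertible_def matrix_vector_mul_assoc matrix_vector_mul_lid)
  ultimately have "w = 0"
    by (metis pform_nondegenerate)
  with w show False by blast
qed

text \<open>For the inclusion from right to left, the line \<open>x + tw\<close> is rescaled so that it stays on
  the quadric.\<close>

lemma tangent_space_quadric:
  assumes x: "x \<in> S"
  shows "tangent_space S x = {v. pform p v (M *v x) = 0}"
proof (intro equalityI subsetI CollectI)
  fix v assume "v \<in> tangent_space S x"
  then obtain \<gamma> \<epsilon> where \<gamma>: "\<epsilon> > 0" "\<gamma> 0 = x" "\<And>t. t \<in> {-\<epsilon><..<\<epsilon>} \<Longrightarrow> \<gamma> t \<in> S"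
    "(\<gamma> has_vector_derivative v) (at (0::real))"
    unfolding tangent_space_def by blast
  let ?q = "\<lambda>t. pform p (\<gamma> t) (M *v \<gamma> t)"
  have "(?q has_real_derivative pform p x (M *v v) + pform p v (M *v x)) (at 0)"
    using pform.has_vector_derivative[OF \<gamma>(4)
        bounded_linear.has_vector_derivative[OF matrix_vector_mul_bounded_linear \<gamma>(4)]]
    by (simp add: \<gamma>(2) has_real_derivative_iff_has_vector_derivative)
  moreover have "\<forall>\<^sub>F t in nhds 0. t \<in> {-\<epsilon><..<\<epsilon>}"
    using \<gamma>(1) by (intro eventually_nhds_in_open) auto
  then have "\<forall>\<^sub>F t in nhds 0. ?q t = c"
    by eventually_elim (use \<gamma>(3) in \<open>simp add: quadric_def\<close>)
  then have "(?q has_real_derivative 0) (at 0)"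
    by (subst DERIV_cong_ev[OF refl _ refl]) auto
  ultimately have "pform p x (M *v v) + pform p v (M *v x) = 0"
    by (rule DERIV_unique)
  then show "pform p v (M *v x) = 0"
    by (simp add: pform_M_commute)
next
  fix w assume "w \<in> {v. pform p v (M *v x) = 0}"
  then have q: "pform p (x + t *\<^sub>R w) (M *v (x + t *\<^sub>R w)) = c + t\<^sup>2 * pform p w (M *v w)" for t
    using x unfolding quadratic_add by (simp add: quadric_def)
  define k where "k = pform p w (M *v w)"
  have "((\<lambda>t. c / (c + t\<^sup>2 * k)) \<longlongrightarrow> c / (c + 0\<^sup>2 * k)) (nhds 0)"
    using c_nonzero by (intro tendsto_intros) (auto simp: tendsto_ident_at filterlim_ident)
  then have "\<forall>\<^sub>F t in nhds 0. c / (c + t\<^sup>2 * k) > 0"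
    using c_nonzero by (intro order_tendstoD) auto
  then obtain \<epsilon> where \<epsilon>: "\<epsilon> > 0" "\<And>t. \<bar>t\<bar> < \<epsilon> \<Longrightarrow> c / (c + t\<^sup>2 * k) > 0"
    by (auto simp: eventually_nhds_metric)
  define \<gamma> where "\<gamma> t = sqrt (c / (c + t\<^sup>2 * k)) *\<^sub>R (x + t *\<^sub>R w)" for t
  have "\<gamma> t \<in> S" if "t \<in> {-\<epsilon><..<\<epsilon>}" for t
  proof -
    have pos: "c / (c + t\<^sup>2 * k) > 0"
      using that by (intro \<epsilon>) auto
    have "pform p (\<gamma> t) (M *v \<gamma> t) = (sqrt (c / (c + t\<^sup>2 * k)))\<^sup>2 * (c + t\<^sup>2 * k)"
      unfolding \<gamma>_def matrix_vector_mult_scaleR pform.scaleR_left pform.scaleR_right q k_def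
      by (simp only: power2_eq_square[of "sqrt _"] mult.assoc real_scaleR_def)
    also have "\<dots> = c"
      unfolding real_sqrt_pow2[OF less_imp_le[OF pos]] using pos by (cases "c + t\<^sup>2 * k = 0") simp_all
    finally show ?thesis
      by (simp add: quadric_def)
  qed
  moreover have "(\<gamma> has_vector_derivative w) (at 0)"
  proof -
    have "((\<lambda>t. sqrt (c / (c + t\<^sup>2 * k))) has_real_derivative 0) (at 0)"
      using c_nonzero by (auto intro!: derivative_eq_intros)
    moreover have "((\<lambda>t. x + t *\<^sub>R w) has_vector_derivative w) (at 0)"
      by (auto intro!: derivative_eq_intros)
    ultimately have "(\<gamma> has_vector_derivative
        sqrt (c / (c + 0\<^sup>2 * k)) *\<^sub>R w + 0 *\<^sub>R (x + 0 *\<^sub>R w)) (at 0)"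
      unfolding \<gamma>_def by (rule has_vector_derivative_scaleR)
    then show ?thesis
      using c_nonzero by simp
  qed
  moreover have "\<gamma> 0 = x"
    using c_nonzero by (simp add: \<gamma>_def)
  ultimately show "w \<in> tangent_space S x"
    unfolding tangent_space_def using \<epsilon>(1) by blast
qed

lemma pform_tangent_nondegenerate:
  assumes "x \<in> S" "pform p v (M *v x) = 0" "\<And>w. pform p w (M *v x) = 0 \<Longrightarrow> pform p v w = 0"
  shows "v = 0"
  using nd assms
  by (auto simp: nondegenerate_hypersurface_def nondegenerate_on_def tangent_space_quadric)

lemma sqnorm_nonzero:
  assumes x: "x \<in> S"
  shows "sqnorm x \<noteq> 0"
proof
  assume "sqnorm x = 0"
  then have "M *v x = 0"
    by (rule pform_tangent_nondegenerate[OF x]) (metis pform_commute)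
  then have "c = 0"
    using x by (simp add: quadric_def pform.zero_right)
  with c_nonzero show False ..
qed

end


subsection \<open>Derivatives along tangent vectors\<close>

lemma has_derivative_within_unique_velocity:
  assumes f: "(f has_derivative D) (at (\<gamma> t) within X)" "(f has_derivative D') (at (\<gamma> t) within X)"
    and \<gamma>: "(\<gamma> has_vector_derivative v) (at t within T)" "\<gamma> ` T \<subseteq> X" and t: "at t within T \<noteq> bot"
  shows "D v = D' v"
proof -
  have "((f \<circ> \<gamma>) has_vector_derivative G v) (at t within T)"
    if "(f has_derivative G) (at (\<gamma> t) within X)" for G
  proof -
    have "((f \<circ> \<gamma>) has_derivative G \<circ> (\<lambda>h. h *\<^sub>R v)) (at t within T)"
      using diff_chain_within[OF \<gamma>(1)[unfolded has_vector_derivative_def]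
          has_derivative_subset[OF that \<gamma>(2)]] .
    then show ?thesis
      using has_derivative_linear[OF that] by (simp add: has_vector_derivative_def linear_cmul comp_def)
  qed
  from vector_derivative_unique_within[OF t this[OF f(1)] this[OF f(2)]] show ?thesis .
qed

lemma pushforward_product_eq:
  fixes f :: "real \<times> 'a::euclidean_space \<Rightarrow> 'b::euclidean_space"
  assumes D: "(f has_derivative D) (at (s, x) within I \<times> S)" and v: "v \<in> tangent_space S x"
    and I: "s \<in> I" "is_interval I" "interior I \<noteq> {}"
  shows "pushforward f (I \<times> S) (s, x) (h, v) = D (h, v)"
proof -
  let ?D' = "pushforward f (I \<times> S) (s, x)"
  have D': "(f has_derivative ?D') (at (s, x) within I \<times> S)"
    unfolding pushforward_def frechet_derivative_works[symmetric]
    using D by (rule differentiableI)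
  obtain \<gamma> \<epsilon> where \<gamma>: "\<epsilon> > 0" "\<gamma> 0 = x" "\<And>t. t \<in> {-\<epsilon><..<\<epsilon>} \<Longrightarrow> \<gamma> t \<in> S"
    "(\<gamma> has_vector_derivative v) (at (0::real))"
    using v unfolding tangent_space_def by blast
  have "x \<in> S"
    using \<gamma>(3)[of 0] \<gamma>(1,2) by simp
  have "I \<noteq> {a}" for a
    using I(3) by auto
  then have "s islimpt I"
    using I(1,2) by (auto intro!: connected_imp_perfect is_interval_connected)
  then have I_bot: "at s within I \<noteq> bot"
    by (simp add: trivial_limit_within)
  have 1: "D (1, 0) = ?D' (1, 0)"
  proof (rule has_derivative_within_unique_velocity[of f D "\<lambda>t. (t, x)" s])
    show "((\<lambda>t. (t, x)) has_vector_derivative (1, 0)) (at s within I)"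
      by (intro has_vector_derivative_Pair has_vector_derivative_const has_vector_derivative_id)
    show "(\<lambda>t. (t, x)) ` I \<subseteq> I \<times> S"
      using \<open>x \<in> S\<close> by blast
  qed (fact D D' I_bot)+
  have 2: "D (0, v) = ?D' (0, v)"
  proof (rule has_derivative_within_unique_velocity[of f D "\<lambda>t. (s, \<gamma> t)" 0])
    show "((\<lambda>t. (s, \<gamma> t)) has_vector_derivative (0, v)) (at 0 within {-\<epsilon><..<\<epsilon>})"
      by (intro has_vector_derivative_Pair has_vector_derivative_const
          has_vector_derivative_at_within[OF \<gamma>(4)])
    show "at 0 within {-\<epsilon><..<\<epsilon>} \<noteq> bot"
      using \<gamma>(1) at_within_open[of 0 "{-\<epsilon><..<\<epsilon>}"] by simp
    show "(\<lambda>t. (s, \<gamma> t)) ` {-\<epsilon><..<\<epsilon>} \<subseteq> I \<times> S"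
      using \<gamma>(3) I(1) by blast
  qed (simp_all only: \<gamma>(2) D D')
  have lin: "G (h, v) = h *\<^sub>R G (1, 0) + G (0, v)" if "(f has_derivative G) (at (s, x) within I \<times> S)" for G
  proof -
    have "G (h *\<^sub>R (1, 0) + (0, v)) = h *\<^sub>R G (1, 0) + G (0, v)"
      using has_derivative_linear[OF that] by (simp only: linear_add linear_cmul)
    then show ?thesis by simp
  qed
  show ?thesis
    unfolding lin[OF D] lin[OF D'] by (simp add: 1 2)
qed

lemma continuous_on_zvec [continuous_intros]:
  assumes "continuous_on X f" "continuous_on X g"
  shows "continuous_on X (\<lambda>u. zvec (f u) (g u))"
  unfolding zvec_def using assms
  by (intro continuous_on_vec_lambda continuous_on_Complex continuous_intros)

context nondegenerate_quadric
begin

subsection \<open>Frames\<close>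

definition normal where "normal x = (1 / sqnorm x) *\<^sub>R (M *v x)"

lemma pform_normal: "x \<in> S \<Longrightarrow> pform p (normal x) (M *v x) = 1"
  by (simp add: normal_def pform.scaleR_left sqnorm_nonzero)

text \<open>The isomorphism \<open>(h, v) \<mapsto> h *\<^sub>R normal x + v\<close> identifies \<open>cylinder_tangent S (s, x)\<close> with
  \<open>real^'n\<close>; \<open>tangent_iso x\<close> is its inverse, and \<open>frame_mat x F\<close> is the matrix of a frame in this
  identification.\<close>

definition tangent_iso where "tangent_iso x b = (pform p b (M *v x), b - pform p b (M *v x) *\<^sub>R normal x)"

definition frame_mat where "frame_mat x F = (\<chi> i. fst (F i) *\<^sub>R normal x + snd (F i))"

lemma cylinder_tangent_quadric:
  "x \<in> S \<Longrightarrow> cylinder_tangent S (s, x) = {(h, v). pform p v (M *v x) = 0}"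
  by (auto simp: cylinder_tangent_def tangent_space_quadric)

lemma linear_tangent_iso: "linear (tangent_iso x)"
  by (rule linearI) (simp_all add: tangent_iso_def pform.add_left pform.scaleR_left algebra_simps)

lemma inj_tangent_iso: "inj (tangent_iso x)"
  by (rule injI) (auto simp: tangent_iso_def)

lemma range_tangent_iso:
  assumes "x \<in> S"
  shows "range (tangent_iso x) = cylinder_tangent S (s, x)"
proof (intro equalityI subsetI)
  fix u assume "u \<in> range (tangent_iso x)"
  then show "u \<in> cylinder_tangent S (s, x)"
    using assms by (auto simp: cylinder_tangent_quadric tangent_iso_def pform.diff_left
        pform.scaleR_left pform_normal)
next
  fix u assume "u \<in> cylinder_tangent S (s, x)"
  then have "u = tangent_iso x (fst u *\<^sub>R normal x + snd u)"
    using assms by (auto simp: cylinder_tangent_quadric tangent_iso_def pform.add_left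
        pform.scaleR_left pform_normal)
  then show "u \<in> range (tangent_iso x)" by blast
qed

lemma subspace_cylinder_tangent: "x \<in> S \<Longrightarrow> subspace (cylinder_tangent S (s, x))"
  by (metis linear_tangent_iso linear_subspace_image range_tangent_iso subspace_UNIV)

lemma dim_cylinder_tangent:
  assumes "x \<in> S"
  shows "dim (cylinder_tangent S (s, x)) = CARD('n)"
  using dim_image_eq[OF linear_tangent_iso[of x], of UNIV] inj_tangent_iso[of x]
  by (simp add: range_tangent_iso[OF assms, of s] dim_UNIV)

lemma frame_of_tangent_iso:
  assumes "x \<in> S"
  shows "frame_of (cylinder_tangent S (s, x)) (\<lambda>i::'n. tangent_iso x (axis i 1))"
proof -
  have range: "range (\<lambda>i::'n. tangent_iso x (axis i 1)) = tangent_iso x ` (Basis :: ((real, 'n) vec) set)"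
    by (auto simp: Basis_vec_def image_iff)
  have "inj (\<lambda>i::'n. tangent_iso x (axis i 1))"
  proof (rule injI)
    fix i j :: 'n assume "tangent_iso x (axis i 1) = tangent_iso x (axis j 1)"
    then have "axis i (1::real) = axis j 1"
      by (rule injD[OF inj_tangent_iso])
    then show "i = j"
      by (simp add: axis_eq_axis)
  qed
  moreover have "independent (tangent_iso x ` (Basis :: ((real, 'n) vec) set))"
    by (intro linear_independent_injective_image linear_tangent_iso independent_Basis
        inj_on_subset[OF inj_tangent_iso]) auto
  moreover have "span (tangent_iso x ` (Basis :: ((real, 'n) vec) set)) = cylinder_tangent S (s, x)"
    by (simp add: linear_span_image[OF linear_tangent_iso] range_tangent_iso[OF assms])
  ultimately show ?thesis
    by (simp add: frame_of_def range)
qed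

lemma frame_mat_tangent_iso: "frame_mat x (\<lambda>i. tangent_iso x (axis i 1)) = mat 1"
  by (simp add: frame_mat_def tangent_iso_def vec_eq_iff mat_def axis_def)

lemma frame_mat_change_of_basis:
  fixes A :: "((real, 'n) vec, 'n) vec"
  assumes "\<And>i. G i = (\<Sum>j\<in>UNIV. A $ i $ j *\<^sub>R F j)"
  shows "frame_mat x G = A ** frame_mat x F"
proof -
  have "frame_mat x G $ i $ k = (A ** frame_mat x F) $ i $ k" for i k
  proof -
    have "frame_mat x G $ i $ k
        = (\<Sum>j\<in>UNIV. A $ i $ j * fst (F j)) * normal x $ k + (\<Sum>j\<in>UNIV. A $ i $ j * snd (F j) $ k)"
      unfolding frame_mat_def assms[of i] vec_lambda_beta fst_sum snd_sum by simp
    also have "\<dots> = (A ** frame_mat x F) $ i $ k"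
      by (simp add: frame_mat_def matrix_matrix_mult_def distrib_left sum.distrib
          sum_distrib_right mult.assoc)
    finally show ?thesis .
  qed
  then show ?thesis
    unfolding vec_eq_iff by blast
qed

definition positive_frame :: "real \<times> (real, 'n) vec \<Rightarrow> ('n \<Rightarrow> real \<times> (real, 'n) vec) \<Rightarrow> bool" where
  "positive_frame u F \<longleftrightarrow> frame_of (cylinder_tangent S u) F \<and> det (frame_mat (snd u) F) > 0"

lemma continuous_on_tangent_iso: "continuous_on S (\<lambda>x. tangent_iso x b)"
  unfolding tangent_iso_def normal_def
  by (intro continuous_intros pform.continuous_on linear_continuous_on
      matrix_vector_mul_bounded_linear) (auto simp: sqnorm_nonzero)

lemma orientation_positive_frame: "orientation (I \<times> S) (cylinder_tangent S) positive_frame"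
  unfolding orientation_def
proof (intro conjI ballI allI impI)
  fix u F G and A :: "((real, 'n) vec, 'n) vec"
  assume "positive_frame u F" "frame_of (cylinder_tangent S u) G"
    "\<forall>i. G i = (\<Sum>j\<in>UNIV. A $ i $ j *\<^sub>R F j)"
  then show "positive_frame u G \<longleftrightarrow> det A > 0"
    by (simp add: positive_frame_def frame_mat_change_of_basis[of G A F] det_mul zero_less_mult_iff)
next
  fix u\<^sub>0 :: "real \<times> (real, 'n) vec"
  let ?F = "\<lambda>u i. tangent_iso (snd u) (axis i 1)"
  have "continuous_on (I \<times> S) (\<lambda>u. ?F u i)" for i
    by (rule continuous_on_compose2[OF continuous_on_tangent_iso]) (auto intro!: continuous_intros)
  moreover have "positive_frame u (?F u)" if "u \<in> I \<times> S" for u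
    using that frame_of_tangent_iso[of "snd u" "fst u"] by (auto simp: positive_frame_def frame_mat_tangent_iso)
  ultimately show "\<exists>U F. open U \<and> u\<^sub>0 \<in> U \<and> (\<forall>i. continuous_on (I \<times> S \<inter> U) (\<lambda>u. F u i)) \<and>
        (\<forall>u\<in>I \<times> S \<inter> U. positive_frame u (F u))"
    by (intro exI[of _ UNIV] exI[of _ ?F]) auto
qed (simp add: positive_frame_def)

end


subsection \<open>The immersion and its angle\<close>

locale rotated_nondegenerate_quadric = nondegenerate_quadric p M c
  for p and M :: "real^'n::{finite,linorder}^'n::{finite,linorder}" and c +
  fixes I :: "real set" and r r' :: "real \<Rightarrow> real"
  assumes I: "is_interval I" "interior I \<noteq> {}"
    and r_pos: "\<And>s. s \<in> I \<Longrightarrow> r s > 0"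
    and r_deriv: "\<And>s. s \<in> I \<Longrightarrow> (r has_real_derivative r' s) (at s within I)"
    and r'_cont: "continuous_on I r'"
begin

abbreviation "f \<equiv> rotated_quadric M r"

abbreviation "df \<equiv> pushforward f (I \<times> S)"

lemma pushforward_rotated_quadric:
  assumes "s \<in> I" "x \<in> S" "(h, v) \<in> cylinder_tangent S (s, x)"
  shows "df (s, x) (h, v)
    = rot M s *v zvec (h *\<^sub>R r' s *\<^sub>R x + r s *\<^sub>R v) (h *\<^sub>R r s *\<^sub>R (M *v x))"
  using pushforward_product_eq[OF has_derivative_rotated_quadric[OF r_deriv] _ _ I] assms
  by (simp add: cylinder_tangent_def)

lemma immersion_rotated_quadric: "immersion_on (I \<times> S) (cylinder_tangent S) f"
  unfolding immersion_on_def
proof (intro conjI ballI)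
  show "f differentiable_on I \<times> S"
    unfolding differentiable_on_def
  proof
    fix u assume "u \<in> I \<times> S"
    then show "f differentiable (at u within I \<times> S)"
      using has_derivative_rotated_quadric[OF r_deriv[of "fst u"], of M "snd u" S]
      by (auto intro: differentiableI)
  qed
next
  have "continuous_on I r"
    using r_deriv by (rule DERIV_continuous_on)
  then have r: "continuous_on X (\<lambda>u. r (g u))"
    if "continuous_on X g" "g ` X \<subseteq> I" for X and g :: "(real \<times> (real, 'n) vec) \<times> (real \<times> (real, 'n) vec) \<Rightarrow> real"
    using continuous_on_compose2 that by blast
  have r': "continuous_on X (\<lambda>u. r' (g u))"
    if "continuous_on X g" "g ` X \<subseteq> I" for X and g :: "(real \<times> (real, 'n) vec) \<times> (real \<times> (real, 'n) vec) \<Rightarrow> real"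
    using continuous_on_compose2[OF r'_cont] that by blast
  have "continuous_on UNIV (rot M)"
    using has_vector_derivative_rot[of M] by (intro continuous_on_vector_derivative) auto
  then have rot: "continuous_on X (\<lambda>u. rot M (g u))" if "continuous_on X g"
    for X and g :: "(real \<times> (real, 'n) vec) \<times> (real \<times> (real, 'n) vec) \<Rightarrow> real"
    using continuous_on_compose2 that by blast
  have "continuous_on (Sigma (I \<times> S) (cylinder_tangent S))
     (\<lambda>((s, x), h, v). rot M s *v zvec (h *\<^sub>R r' s *\<^sub>R x + r s *\<^sub>R v) (h *\<^sub>R r s *\<^sub>R (M *v x)))"
    unfolding case_prod_beta
    by (intro cmv.continuous_on rot r r' continuous_intros
        bounded_linear.continuous_on[OF matrix_vector_mul_bounded_linear]) auto
  then show "continuous_on (Sigma (I \<times> S) (cylinder_tangent S)) (\<lambda>(u, v). df u v)"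
    by (rule continuous_on_eq) (auto simp: pushforward_rotated_quadric)
next
  fix u assume "u \<in> I \<times> S"
  then obtain s x where u: "u = (s, x)" "s \<in> I" "x \<in> S" by auto
  then have Mx: "M *v x \<noteq> 0"
    using sqnorm_nonzero[of x] by (auto simp: pform.zero_left)
  show "inj_on (df u) (cylinder_tangent S u)"
  proof (rule inj_onI, clarify)
    fix h v k w
    assume T: "(h, v) \<in> cylinder_tangent S u" "(k, w) \<in> cylinder_tangent S u"
      and eq: "df u (h, v) = df u (k, w)"
    have "zvec (h *\<^sub>R r' s *\<^sub>R x + r s *\<^sub>R v) (h *\<^sub>R r s *\<^sub>R (M *v x))
        = zvec (k *\<^sub>R r' s *\<^sub>R x + r s *\<^sub>R w) (k *\<^sub>R r s *\<^sub>R (M *v x))"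
      using eq T u by (simp add: pushforward_rotated_quadric rot_mult_eq_iff)
    then have re: "h *\<^sub>R r' s *\<^sub>R x + r s *\<^sub>R v = k *\<^sub>R r' s *\<^sub>R x + r s *\<^sub>R w"
      and im: "h *\<^sub>R r s *\<^sub>R (M *v x) = k *\<^sub>R r s *\<^sub>R (M *v x)"
      by (simp_all add: zvec_def vec_eq_iff)
    have "h = k"
      using im Mx r_pos[of s] u by simp
    with re show "h = k \<and> v = w"
      using r_pos[of s] u by simp
  qed
qed

lemma lagrangian_rotated_quadric: "lagrangian_immersion p (I \<times> S) (cylinder_tangent S) f"
  unfolding lagrangian_immersion_def
proof (intro conjI ballI immersion_rotated_quadric)
  fix u assume "u \<in> I \<times> S"
  then obtain s x where u: "u = (s, x)" "s \<in> I" "x \<in> S" by auto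
  show "subspace (cylinder_tangent S u)" "dim (cylinder_tangent S u) = CARD('n)"
    using u by (simp_all add: subspace_cylinder_tangent dim_cylinder_tangent)
  fix v w assume T: "v \<in> cylinder_tangent S u" "w \<in> cylinder_tangent S u"
  obtain h a k b where vw: "v = (h, a)" "w = (k, b)" by (cases v, cases w)
  have "pform p a (M *v x) = 0" "pform p (M *v x) b = 0"
    using T u by (auto simp: vw cylinder_tangent_quadric pform_commute)
  then show "omega p (df u v) (df u w) = 0"
    using T u pform_commute[of p "M *v x" x]
    by (simp add: vw pushforward_rotated_quadric omega_rot_zvec[OF sa] pform.add_left
        pform.add_right pform.scaleR_left pform.scaleR_right)
qed

lemma nondegenerate_pushforward:
  assumes u: "u \<in> I \<times> S"
  shows "nondegenerate_on (\<lambda>v w. cmetric p (df u v) (df u w)) (cylinder_tangent S u)"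
  unfolding nondegenerate_on_def
proof (intro ballI impI)
  obtain s x where u: "u = (s, x)" "s \<in> I" "x \<in> S"
    using assms by auto
  fix z assume z: "z \<in> cylinder_tangent S u"
    and orth: "\<forall>w\<in>cylinder_tangent S u. cmetric p (df u z) (df u w) = 0"
  obtain h v where hv: "z = (h, v)" by (cases z)
  let ?N = "M *v x"
  define m where "m = pform p ?N ?N"
  have m: "m \<noteq> 0"
    using sqnorm_nonzero u by (simp add: m_def)
  have r: "r s > 0"
    using r_pos u by simp
  have x: "pform p x ?N = c"
    using u by (simp add: quadric_def)
  have v: "pform p v ?N = 0"
    using z u by (simp add: hv cylinder_tangent_quadric)
  define a where "a = h *\<^sub>R r' s *\<^sub>R x + r s *\<^sub>R v"
  have a: "pform p a ?N = h * r' s * c"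
    using v x by (simp add: a_def pform.add_left pform.scaleR_left)
  have metric: "pform p a (k *\<^sub>R r' s *\<^sub>R x + r s *\<^sub>R w) + h * k * (r s)\<^sup>2 * m = 0"
    if "pform p w ?N = 0" for k w
  proof -
    have "(k, w) \<in> cylinder_tangent S u"
      using that u by (simp add: cylinder_tangent_quadric)
    with orth have "cmetric p (df u z) (df u (k, w)) = 0" by blast
    then show ?thesis
      using z u \<open>(k, w) \<in> _\<close>
      by (simp add: hv pushforward_rotated_quadric cmetric_rot_zvec[OF sa] a_def m_def
          pform.scaleR_left pform.scaleR_right power2_eq_square mult_ac)
  qed
  define l where "l = h * r' s * c / m"
  have "a - l *\<^sub>R ?N = 0"
  proof (rule pform_tangent_nondegenerate[OF u(3)])
    show "pform p (a - l *\<^sub>R ?N) ?N = 0"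
      using a m by (simp add: pform.diff_left pform.scaleR_left l_def flip: m_def)
    show "pform p (a - l *\<^sub>R ?N) w = 0" if "pform p w ?N = 0" for w
      using metric[OF that, of 0] r that
      by (simp add: pform.diff_left pform.scaleR_left pform.scaleR_right pform_commute[of p "M *v x" w])
  qed
  then have al: "a = l *\<^sub>R ?N" by simp
  have "pform p a x = l * c"
    using x by (simp add: al pform.scaleR_left pform_commute[of p _ x])
  then have "r' s * (l * c) + h * (r s)\<^sup>2 * m = 0"
    using metric[of 0 1] by (simp add: pform.zero_left pform.scaleR_right)
  moreover have "h * ((r' s * c)\<^sup>2 + (r s * m)\<^sup>2) = (h * r' s * c) * (r' s * c) + h * (r s)\<^sup>2 * m * m"
    by (simp add: power2_eq_square algebra_simps)
  then have "h * ((r' s * c)\<^sup>2 + (r s * m)\<^sup>2) = m * (r' s * (l * c) + h * (r s)\<^sup>2 * m)"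
    using m by (simp add: l_def algebra_simps)
  ultimately have "h * ((r' s * c)\<^sup>2 + (r s * m)\<^sup>2) = 0"
    by simp
  then have "h = 0"
    using r m by (auto simp: sum_power2_eq_zero_iff)
  then have "a = 0"
    by (simp add: al l_def)
  with \<open>h = 0\<close> show "z = 0"
    using r by (simp add: a_def hv zero_prod_def)
qed

lemma Omega_pushforward:
  assumes s: "s \<in> I" and x: "x \<in> S" and F: "\<And>i. F i \<in> cylinder_tangent S (s, x)"
  shows "Omega (\<lambda>i. df (s, x) (F i)) = of_real (r s ^ CARD('n) * det (frame_mat x F)) *
    (cis (trace M * s) * Complex (c * r' s / r s) (sqnorm x))"
proof -
  define Z :: "((complex, 'n) vec, 'n) vec" where
    "Z = (\<chi> i. zvec (fst (F i) *\<^sub>R r' s *\<^sub>R x + r s *\<^sub>R snd (F i)) (fst (F i) *\<^sub>R r s *\<^sub>R (M *v x)))"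
  define B where "B = map_matrix complex_of_real (frame_mat x F)"
  define q :: "(complex, 'n) vec" where "q = (\<chi> j. of_real (psign p j * (M *v x) $ j))"
  define d where "d = zvec ((r' s / r s) *\<^sub>R x - normal x) (M *v x)"
  have r: "r s > 0"
    using r_pos s by simp
  have qpform: "(\<Sum>j\<in>UNIV. q $ j * zvec a b $ j) = Complex (pform p a (M *v x)) (pform p b (M *v x))" for a b
    by (simp add: complex_eq_iff q_def zvec_def pform_def mult_ac)
  have Bi: "B $ i = zvec (fst (F i) *\<^sub>R normal x + snd (F i)) 0" for i
    by (simp add: B_def frame_mat_def zvec_def vec_eq_iff complex_of_real_def)
  have Bq: "(B *v q) $ i = of_real (fst (F i))" for i
  proof -
    have "pform p (snd (F i)) (M *v x) = 0"
      using F[of i] x by (auto simp: cylinder_tangent_quadric)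
    moreover have "(B *v q) $ i = (\<Sum>j\<in>UNIV. q $ j * B $ i $ j)"
      by (simp add: matrix_vector_mult_def mult.commute)
    ultimately show ?thesis
      using x qpform[of "fst (F i) *\<^sub>R normal x + snd (F i)" 0]
      by (simp add: Bi pform.add_left pform.scaleR_left pform.zero_left pform_normal
          complex_of_real_def)
  qed
  have "pushforward f (I \<times> S) (s, x) (F i) = rot M s *v Z $ i" for i
    using pushforward_rotated_quadric[OF s x, of "fst (F i)" "snd (F i)"] F[of i] by (simp add: Z_def)
  then have "Omega (\<lambda>i. df (s, x) (F i)) = det (Z ** transpose (rot M s))"
    by (auto simp: Omega_def intro!: arg_cong[where f = det]
        simp: vec_eq_iff matrix_matrix_mult_def matrix_vector_mult_def transpose_def mult_ac)
  also have "\<dots> = cis (trace M * s) * det Z"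
    by (simp add: det_mul det_rot)
  also have "Z = (\<chi> i. of_real (r s) *s (B $ i + (B *v q) $ i *s d))"
    using r by (auto simp: Bq Bi Z_def d_def zvec_def vec_eq_iff complex_eq_iff field_simps)
  also have "det \<dots> = of_real (r s ^ CARD('n)) * (of_real (det (frame_mat x F)) * (1 + (\<Sum>i\<in>UNIV. q $ i * d $ i)))"
    unfolding det_rows_mul det_rank_one_update B_def det_map_matrix_of_real by simp
  also have "1 + (\<Sum>i\<in>UNIV. q $ i * d $ i) = Complex (c * r' s / r s) (sqnorm x)"
    using x unfolding d_def qpform
    by (simp add: complex_eq_iff pform.diff_left pform.scaleR_left pform_normal quadric_def)
  finally show ?thesis by (simp add: mult_ac)
qed

lemma lagrangian_angle_rotated_quadric:
  "lagrangian_angle p (I \<times> S) (cylinder_tangent S) positive_frame f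
     (\<lambda>(s, x). trace M * s + Arg (Complex (c * r' s / r s) (sqnorm x)))"
  unfolding lagrangian_angle_def
proof (intro ballI conjI allI impI nondegenerate_pushforward)
  fix u F assume u: "u \<in> I \<times> S" and P: "positive_frame u F"
  obtain s x where sx: "u = (s, x)" "s \<in> I" "x \<in> S"
    using u by auto
  have "F i \<in> cylinder_tangent S (s, x)" for i
    using P span_base[of "F i" "range F"] by (auto simp: positive_frame_def frame_of_def sx)
  note \<Omega> = Omega_pushforward[OF sx(2,3) this]
  define k where "k = r s ^ CARD('n) * det (frame_mat x F)"
  define w where "w = Complex (c * r' s / r s) (sqnorm x)"
  have k: "k > 0"
    using P r_pos[OF sx(2)] by (simp add: k_def positive_frame_def sx)
  have w: "w \<noteq> 0"
    using sqnorm_nonzero[OF sx(3)] by (simp add: w_def complex_eq_iff)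
  have \<Omega>': "Omega (\<lambda>i. df u (F i)) = of_real k * (cis (trace M * s) * w)"
    unfolding sx \<Omega> k_def w_def ..
  show nz: "Omega (\<lambda>i. df u (F i)) \<noteq> 0"
    using k w by (simp add: \<Omega>')
  have "cis (Arg (Omega (\<lambda>i. df u (F i)))) = cis (trace M * s) * sgn w"
    using nz k by (simp add: cis_Arg \<Omega>' sgn_mult sgn_of_real sgn_cis)
  also have "\<dots> = cis (trace M * s + Arg w)"
    using w by (simp add: cis_Arg flip: cis_mult)
  finally show "[Arg (Omega (\<lambda>i. df u (F i))) = (case u of (s, x) \<Rightarrow> trace M * s +
      Arg (Complex (c * r' s / r s) (sqnorm x)))] (rmod (2 * pi))"
    by (simp add: sx w_def cis_eq_iff)
qed

end

theorem theorem4: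
  fixes M :: "real^'n::{finite,linorder}^'n::{finite,linorder}" and p :: nat and c :: real
    and I :: "real set" and r r' :: "real \<Rightarrow> real"
    and S :: "(real^'n::{finite,linorder}) set"
  assumes "S = quadric p M c" and "p \<le> CARD('n)"
    and "invertible M" and "self_adjoint p M"
    and "nondegenerate_hypersurface p S"
    and "CARD('n) = 1 \<longrightarrow> c \<noteq> 0"
    and "is_interval I" and "interior I \<noteq> {}"
    and "\<forall>s\<in>I. r s > 0"
    and "\<forall>s\<in>I. (r has_real_derivative r' s) (at s within I)" and "continuous_on I r'"
  shows "lagrangian_immersion p (I \<times> S) (cylinder_tangent S) (rotated_quadric M r) \<and>
    (\<exists>P. orientation (I \<times> S) (cylinder_tangent S) P \<and>
       lagrangian_angle p (I \<times> S) (cylinder_tangent S) P (rotated_quadric M r)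
         (\<lambda>(s, x). trace M * s +
            Arg (Complex (c * r' s / r s) (pform p (M *v x) (M *v x)))))"
proof -
  interpret rotated_nondegenerate_quadric p M c I r r'
    using assms by unfold_locales auto
  show ?thesis
    unfolding assms(1)
    using lagrangian_rotated_quadric orientation_positive_frame lagrangian_angle_rotated_quadric
    by blast
qed

end
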